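(* Let $G$ be a forest containing no isolated edges. Then $\chi'_t(G)\leq\Delta(G)+2$ if $\Delta(G)$ is odd, and $\chi'_t(G)\leq\Delta(G)+3$ otherwise.
   Context: An isolated edge is a connected component isomorphic to $K_2$. A twin edge $k$-coloring of a graph $G$ is a proper edge labeling $f:E(G)\to\mathbb{Z}_k$ (adjacent edges receive distinct labels) such that the induced vertex coloring $w(v)=\sum_{u\in N(v)}f(uv)\pmod k$ satisfies $w(u)\neq w(v)$ for every edge $uv$. The twin chromatic index $\chi'_t(G)$ is the least integer $k\geq 2$ for which $G$ has a twin edge $k$-coloring. $\Delta(G)$ is the maximum degree. *)

theory Defs
  imports "Graph_Theory.Graph_Theory" "HOL-Library.Extended_Nat"
begin

text \<open>
  A finite simple graph is a \<^const>\<open>graph\<close> in the sense of \<^theory>\<open>Graph_Theory.Digraph\<close>,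
  i.e. a symmetric digraph without loops and parallel arcs; an undirected edge \<open>uv\<close> is the
  two-element set \<open>{u, v}\<close>, represented in the digraph by the two arcs between \<open>u\<close> and \<open>v\<close>.
\<close>

definition edges :: "('a, 'b) pre_digraph \<Rightarrow> 'a set set" where
  "edges G = {{u, v} | u v. u \<rightarrow>\<^bsub>G\<^esub> v}"

definition neighbourhood :: "('a, 'b) pre_digraph \<Rightarrow> 'a \<Rightarrow> 'a set" where
  "neighbourhood G v = {u. v \<rightarrow>\<^bsub>G\<^esub> u}"

text \<open>The supremum over the empty set of natural numbers is 0, so the null graph gets value 0.\<close>

definition max_degree :: "('a, 'b) pre_digraph \<Rightarrow> nat" where
  "max_degree G = (SUP v\<in>verts G. card (neighbourhood G v))"

text \<open>
  The library predicate \<^const>\<open>forest\<close> also forbids the directed 2-cycles \<open>u, v, u\<close>, which every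
  edge of a symmetric digraph gives rise to. The cycles of a simple undirected graph are
  the directed cycles of length at least 3.
\<close>

definition undirected_forest :: "('a, 'b) pre_digraph \<Rightarrow> bool" where
  "undirected_forest G \<longleftrightarrow> graph G \<and> \<not> (\<exists>p. pre_digraph.cycle G p \<and> 3 \<le> length p)"

definition isolated_edge :: "('a, 'b) pre_digraph \<Rightarrow> ('a, 'b) pre_digraph \<Rightarrow> bool" where
  "isolated_edge G H \<longleftrightarrow> pre_digraph.max_subgraph G connected H \<and> complete_digraph 2 H"

text \<open>The elements of \<open>\<int>\<^sub>k\<close> are represented by the residues \<open>0, \<dots>, k - 1\<close>.\<close>

definition proper_edge_labeling ::
  "('a, 'b) pre_digraph \<Rightarrow> nat \<Rightarrow> ('a set \<Rightarrow> nat) \<Rightarrow> bool" where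
  "proper_edge_labeling G k f \<longleftrightarrow>
     (\<forall>e\<in>edges G. f e < k) \<and>
     (\<forall>e\<in>edges G. \<forall>e'\<in>edges G. e \<noteq> e' \<and> e \<inter> e' \<noteq> {} \<longrightarrow> f e \<noteq> f e')"

definition induced_color ::
  "('a, 'b) pre_digraph \<Rightarrow> nat \<Rightarrow> ('a set \<Rightarrow> nat) \<Rightarrow> 'a \<Rightarrow> nat" where
  "induced_color G k f v = (\<Sum>u\<in>neighbourhood G v. f {u, v}) mod k"

definition twin_edge_coloring ::
  "('a, 'b) pre_digraph \<Rightarrow> nat \<Rightarrow> ('a set \<Rightarrow> nat) \<Rightarrow> bool" where
  "twin_edge_coloring G k f \<longleftrightarrow>
     proper_edge_labeling G k f \<and>
     (\<forall>u v. u \<rightarrow>\<^bsub>G\<^esub> v \<longrightarrow> induced_color G k f u \<noteq> induced_color G k f v)"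

text \<open>
  The least \<open>k \<ge> 2\<close> admitting a twin edge \<open>k\<close>-coloring, and \<open>\<infinity>\<close> if there is none; an upper
  bound by a natural number thus includes the existence of such a coloring.
\<close>

definition twin_chromatic_index :: "('a, 'b) pre_digraph \<Rightarrow> enat" where
  "twin_chromatic_index G = (INF k\<in>{k. 2 \<le> k \<and> (\<exists>f. twin_edge_coloring G k f)}. enat k)"

end

theory Submission
  imports Defs
begin

text \<open>
  Put \<open>k = \<Delta> + 2\<close> or \<open>k = \<Delta> + 3\<close>, whichever is odd, so that the nonzero residues split into pairs
  \<open>{i, -i}\<close> of sum zero. Root every nontrivial component at the neighbour of a leaf and label the
  edges from the root downwards. A vertex whose parent edge has label \<open>c \<noteq> 0\<close> and whose parent has
  colour \<open>a \<noteq> c\<close> gives its \<open>d \<le> k - 3\<close> child edges a set \<open>A\<close> of labels, not containing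
  \<open>0\<close> or \<open>c\<close>, such that its own colour \<open>c + \<Sum>A\<close> is neither \<open>a\<close> nor an element of \<open>A\<close>;
  the latter takes care of leaves and gives \<open>a \<noteq> c\<close> again one level down. The set \<open>A\<close> consists
  of pairs, together with the following elements if \<open>d\<close> is odd:
  a single element if \<open>d = 1\<close>; \<open>-c\<close> if \<open>a \<noteq> 0\<close>; \<open>-2c\<close> if \<open>a = 0\<close> and \<open>3c \<noteq> 0\<close>;
  \<open>-c, -1, 2\<close> if \<open>a = 3c = 0\<close>.
  A root of odd degree uses \<open>0, -1, 2\<close> and pairs, the label \<open>0\<close> going to its leaf.
\<close>

section \<open>Label sets with prescribed sums\<close>

text \<open>The nonzero residues split into \<open>m\<close> classes \<open>{i, k - i}\<close> with
  \<open>i\<close> in \<open>{1..m}\<close>. Each \<open>x\<close> in \<open>X\<close> blocks at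
  most one class, that of \<open>min x (k - x)\<close>, so at least \<open>j\<close> classes remain;
  each adds exactly \<open>k\<close> to the sum.\<close>

lemma symmetric_pairs_exist:
  fixes m j :: nat and X :: "nat set"
  defines "k \<equiv> 2 * m + 1"
  assumes "finite X" and "j + card X \<le> m"
  obtains Q where "Q \<subseteq> {1..<k}" "card Q = 2 * j" "\<Sum>Q mod k = 0"
    "\<And>x. x \<in> X \<Longrightarrow> x \<notin> Q \<and> k - x \<notin> Q"
proof -
  let ?Y = "{1..m} - (\<lambda>x. min x (k - x)) ` X"
  have "card ((\<lambda>x. min x (k - x)) ` X) \<le> card X"
    by (rule card_image_le) fact
  moreover have "card {1..m} - card ((\<lambda>x. min x (k - x)) ` X) \<le> card ?Y"
    by (rule diff_card_le_card_Diff) (simp add: \<open>finite X\<close>)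
  ultimately have "j \<le> card ?Y"
    using assms(3) by simp
  then obtain J where J: "J \<subseteq> ?Y" "card J = j" "finite J"
    by (meson obtain_subset_with_card_n)
  define Q where "Q = J \<union> (\<lambda>i. k - i) ` J"
  have J_bounds: "1 \<le> i" "i \<le> m" if "i \<in> J" for i
    using J(1) that by auto
  have inj: "inj_on (\<lambda>i. k - i) J"
    using J_bounds by (force simp: inj_on_def k_def)
  have disj: "J \<inter> (\<lambda>i. k - i) ` J = {}"
  proof -
    have "k - i \<noteq> i'" if "i \<in> J" "i' \<in> J" for i i'
      using J_bounds[OF that(1)] J_bounds[OF that(2)] by (simp add: k_def)
    then show ?thesis by blast
  qed
  have card: "card Q = 2 * j"
    using J inj disj by (simp add: Q_def card_Un_disjoint card_image)
  have subset: "Q \<subseteq> {1..<k}"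
    using J_bounds by (force simp: Q_def k_def)
  have sum: "\<Sum>Q mod k = 0"
  proof -
    have "\<Sum>Q = (\<Sum>i\<in>J. i + (k - i))"
      using J disj by (simp add: Q_def sum.union_disjoint sum.reindex[OF inj] sum.distrib)
    also have "\<dots> = (\<Sum>i\<in>J. k)"
      using J_bounds by (intro sum.cong) (force simp: k_def)+
    finally show ?thesis by simp
  qed
  have avoid: "x \<notin> Q \<and> k - x \<notin> Q" if x: "x \<in> X" for x
  proof -
    have min: "min x (k - x) \<notin> J"
      using J(1) x by blast
    have "x \<noteq> i \<and> x \<noteq> k - i \<and> k - x \<noteq> i \<and> k - x \<noteq> k - i" if "i \<in> J" for i
    proof -
      have "min x (k - x) \<noteq> i"
        using min that by blast
      then show ?thesis
        using J_bounds[OF that] by (auto simp: k_def min_def split: if_splits)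
    qed
    then show ?thesis
      unfolding Q_def by blast
  qed
  show thesis
    by (rule that[OF subset card sum avoid])
qed

text \<open>Here \<open>c\<close> is the label of the parent edge and \<open>a\<close> the colour of
  the parent. With \<open>k = 2 * m + 1\<close>, the set needs at most \<open>m - 1\<close> pairs if
  \<open>d\<close> is even, \<open>m - 2\<close> if \<open>d\<close> is odd and one element is
  added, and \<open>m - 3\<close> if three are added. So one, two or three classes can be kept free,
  just as many as each case blocks.\<close>

lemma child_labels_exist:
  fixes k d c a :: nat
  assumes k: "odd k" "5 \<le> k" and c: "0 < c" "c < k" "a \<noteq> c" and d: "1 \<le> d" "d \<le> k - 3"
  obtains A where "A \<subseteq> {1..<k} - {c}" "card A = d"
    "(c + \<Sum>A) mod k \<notin> A" "(c + \<Sum>A) mod k \<noteq> a"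
proof -
  obtain m where m: "k = 2 * m + 1"
    using k(1) by (elim oddE)
  note pairs = symmetric_pairs_exist[where m = m, folded m]
  have sum0: "(s + \<Sum>Q) mod k = s mod k" if "\<Sum>Q mod k = 0" for s and Q :: "nat set"
    using that mod_add_right_eq[of s "\<Sum>Q" k] by simp
  have fin: "finite Q" if "Q \<subseteq> {1..<k}" for Q
    using that by (rule finite_subset) simp
  consider (even) "even d" | (one) "d = 1"
    | (nonzero) "odd d" "3 \<le> d" "a \<noteq> 0"
    | (zero) "odd d" "3 \<le> d" "a = 0" "(3 * c) mod k \<noteq> 0"
    | (third) "odd d" "3 \<le> d" "a = 0" "(3 * c) mod k = 0"
  proof -
    have "even d \<or> d = 1 \<or> odd d \<and> 3 \<le> d"
      using d(1) by presburger
    then show ?thesis using that by blast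
  qed
  then show thesis
  proof cases
    case even
    then obtain j where j: "d = 2 * j" by blast
    have "j + card {c} \<le> m" using d k j m by simp
    then obtain Q where Q: "Q \<subseteq> {1..<k}" "card Q = 2 * j" "\<Sum>Q mod k = 0"
      "\<And>x. x \<in> {c} \<Longrightarrow> x \<notin> Q \<and> k - x \<notin> Q"
      using pairs[of "{c}" j] by blast
    \<comment> \<open>The pairs add nothing, so the colour is \<open>c\<close> itself, which differs
      from \<open>a\<close> by assumption.\<close>
    show thesis
      by (rule that[of Q]) (use Q j c in \<open>auto simp: sum0\<close>)
  next
    case one
    let ?f = "\<lambda>x. (c + x) mod k"
    have f: "?f x = (if c + x < k then c + x else c + x - k)" if "x < k" for x
      using that c by (simp add: le_mod_geq)
    \<comment> \<open>Of three distinct residues, at most one equals \<open>c\<close> and at most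
      one is sent to \<open>a\<close> by the translation \<open>?f\<close>.\<close>
    have "\<exists>x\<in>{1, 2, 3}. x \<noteq> c \<and> ?f x \<noteq> a"
      using k c f[of 1] f[of 2] f[of 3] by (auto split: if_splits)
    then obtain x where x: "x \<in> {1, 2, 3}" "x \<noteq> c" "?f x \<noteq> a" by blast
    then have "?f x \<noteq> x"
      using f[of x] c k by (auto split: if_splits)
    show thesis
      by (rule that[of "{x}"]) (use x k one \<open>?f x \<noteq> x\<close> in auto)
  next
    case nonzero
    then obtain j where j: "d = 2 * j + 1" by (elim oddE)
    have "j + card {c} \<le> m" using d k j m by simp
    then obtain Q where Q: "Q \<subseteq> {1..<k}" "card Q = 2 * j" "\<Sum>Q mod k = 0"
      "\<And>x. x \<in> {c} \<Longrightarrow> x \<notin> Q \<and> k - x \<notin> Q"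
      using pairs[of "{c}" j] by blast
    have ne: "k - c \<noteq> c" using m c by presburger
    \<comment> \<open>Colour 0 is safe: it is not \<open>a\<close>, and all labels in the set are
      positive.\<close>
    have "(c + \<Sum>(insert (k - c) Q)) mod k = 0"
      using Q c fin[OF Q(1)] sum0[OF Q(3), of k] by simp
    then show thesis
      by (intro that[of "insert (k - c) Q"]) (use Q j c ne nonzero fin[OF Q(1)] in auto)
  next
    case zero
    then obtain j where j: "d = 2 * j + 1" by (elim oddE)
    \<comment> \<open>The representative of -2c in \<open>{1..<k}\<close>; the colour becomes -c,
      which is nonzero and hence not \<open>a\<close>. Blocking the class of \<open>c\<close> keeps
      -c out of \<open>Q\<close>.\<close>
    define x where "x = (if 2 * c < k then k - 2 * c else 2 * k - 2 * c)"
    have x: "0 < x" "x < k" "x \<noteq> c" "c + x = k - c \<or> c + x = 2 * k - c"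
    proof -
      have "3 * c \<noteq> k" "3 * c \<noteq> 2 * k"
        using zero(4) by auto
      moreover have "2 * c \<noteq> k"
        using k(1) by auto
      moreover have "x + 2 * c = k \<or> x + 2 * c = 2 * k \<and> k < 2 * c"
        using c \<open>2 * c \<noteq> k\<close> by (auto simp: x_def)
      ultimately show "0 < x" "x < k" "x \<noteq> c" "c + x = k - c \<or> c + x = 2 * k - c"
        using c by linarith+
    qed
    have xk: "x \<noteq> k - c" "k - c \<noteq> c"
      using x c m by auto
    have "j + card {c, x} \<le> m" using d k j m x by simp
    then obtain Q where Q: "Q \<subseteq> {1..<k}" "card Q = 2 * j" "\<Sum>Q mod k = 0"
      "\<And>y. y \<in> {c, x} \<Longrightarrow> y \<notin> Q \<and> k - y \<notin> Q"
      using pairs[of "{c, x}" j] by blast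
    have "(c + x) mod k = k - c"
    proof -
      have "c + x = k - c \<or> c + x = k + (k - c)"
        using x(4) c by linarith
      moreover have "(k - c) mod k = k - c"
        using c by simp
      ultimately show ?thesis
        by (metis mod_add_self1)
    qed
    then have "(c + \<Sum>(insert x Q)) mod k = k - c"
      using Q c fin[OF Q(1)] sum0[OF Q(3), of "c + x"] by (simp add: add.assoc)
    then show thesis
      by (intro that[of "insert x Q"]) (use Q j c xk x zero fin[OF Q(1)] in auto)
  next
    case third
    from third(1,2) have "\<exists>j. d = 2 * j + 3" by presburger
    then obtain j where j: "d = 2 * j + 3" ..
    have "3 * c = k \<or> 3 * c = 2 * k"
    proof -
      obtain q where q: "3 * c = k * q" using third(4) by auto
      then have "k * q < k * 3" "0 < k * q" using c by linarith+
      then have "q = 1 \<or> q = 2" by auto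
      with q show ?thesis by auto
    qed
    \<comment> \<open>The bounds \<open>3 \<le> d \<le> k - 3\<close> and the oddness of
      \<open>k\<close> give \<open>7 \<le> k\<close>. As \<open>c\<close> is a third or two thirds
      of \<open>k\<close>, it is then far enough from 0 for -c, -1 and 2 to be distinct and
      different from 1.\<close>
    moreover have "7 \<le> k"
      using k d j by presburger
    ultimately have far: "3 \<le> c" "c + 3 \<le> k"
      by presburger+
    have "j + card {c, 1, 2} \<le> m" using d k j m far by simp
    then obtain Q where Q: "Q \<subseteq> {1..<k}" "card Q = 2 * j" "\<Sum>Q mod k = 0"
      "\<And>y. y \<in> {c, 1, 2} \<Longrightarrow> y \<notin> Q \<and> k - y \<notin> Q"
      using pairs[of "{c, 1, 2}" j] by blast
    have notin: "k - c \<notin> Q" "k - 1 \<notin> Q" "2 \<notin> Q" "1 \<notin> Q" "c \<notin> Q" using Q(4) by auto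
    have distinct: "k - c \<noteq> k - 1" "k - c \<noteq> 2" "k - 1 \<noteq> 2" "k - c \<noteq> c"
      using far k(1) by presburger+
    let ?A = "insert (k - c) (insert (k - 1) (insert 2 Q))"
    have "c + \<Sum>?A = (2 * k + 1) + \<Sum>Q"
      using notin distinct far fin[OF Q(1)] by simp
    then have "(c + \<Sum>?A) mod k = 1"
      using sum0[OF Q(3), of "2 * k + 1"] far by (simp add: mod_Suc)
    moreover have "card ?A = d"
      using Q(2) j notin distinct fin[OF Q(1)] by simp
    moreover have "?A \<subseteq> {1..<k} - {c}"
      using Q(1) notin(5) distinct(4) far by auto
    moreover have "1 \<notin> ?A"
      using notin(4) far by auto
    ultimately show thesis
      by (intro that[of ?A]) (simp_all only: third(3), simp)
  qed
qed

text \<open>For even \<open>d\<close> pairs suffice, with colour 0. For odd \<open>d\<close>, pairs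
  and one element would have that element as their sum, hence the triple 0, -1, 2 with colour 1.
  Label 0 is unavoidable for \<open>d = k - 2\<close>: that many nonzero residues omit one residue y
  and sum to -y, which is among them.\<close>

lemma root_labels_exist:
  fixes k d :: nat
  assumes k: "odd k" "5 \<le> k" and d: "2 \<le> d" "d \<le> k - 2"
  obtains A where "A \<subseteq> {..<k}" "card A = d" "\<Sum>A mod k \<notin> A"
proof -
  obtain m where m: "k = 2 * m + 1"
    using k(1) by (elim oddE)
  note pairs = symmetric_pairs_exist[where m = m, folded m]
  show thesis
  proof (cases "even d")
    case True
    then obtain j where j: "d = 2 * j" by blast
    have "j + card {} \<le> m" using d k j m by simp
    then obtain Q where Q: "Q \<subseteq> {1..<k}" "card Q = 2 * j" "\<Sum>Q mod k = 0"
      using pairs[of "{}" j] by (metis finite.emptyI)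
    show thesis
      by (rule that[of Q]) (use Q j in auto)
  next
    case False
    with d have "\<exists>j. d = 2 * j + 3" by presburger
    then obtain j where j: "d = 2 * j + 3" ..
    have "j + card {1, 2::nat} \<le> m" using d k j m by simp
    then obtain Q where Q: "Q \<subseteq> {1..<k}" "card Q = 2 * j" "\<Sum>Q mod k = 0"
      "\<And>y. y \<in> {1, 2} \<Longrightarrow> y \<notin> Q \<and> k - y \<notin> Q"
      using pairs[of "{1, 2}" j] by blast
    have notin: "k - 1 \<notin> Q" "2 \<notin> Q" "1 \<notin> Q" "0 \<notin> Q" using Q by auto
    let ?A = "insert 0 (insert (k - 1) (insert 2 Q))"
    have fin: "finite Q" using Q(1) by (rule finite_subset) simp
    have "\<Sum>?A = (k + 1) + \<Sum>Q"
      using notin k fin by simp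
    then have "\<Sum>?A mod k = 1"
      using Q(3) k mod_add_right_eq[of "k + 1" "\<Sum>Q" k] by (simp add: mod_Suc)
    then show thesis
      by (intro that[of ?A]) (use Q j notin fin k in auto)
  qed
qed

section \<open>Rooting a forest\<close>

text \<open>The value is unspecified if \<open>x\<close> cannot be reached from \<open>r\<close>, so
  reachability accompanies its use below.\<close>

definition rel_dist :: "('a \<times> 'a) set \<Rightarrow> 'a \<Rightarrow> 'a \<Rightarrow> nat" where
  "rel_dist R r x = (LEAST n. (r, x) \<in> R ^^ n)"

text \<open>
  For a symmetric relation this is the absence of cycles of length at least 3: two distinct
  neighbours of \<open>v\<close> are not joined by a walk avoiding \<open>v\<close>.
\<close>

definition rel_acyclic :: "('a \<times> 'a) set \<Rightarrow> bool" where
  "rel_acyclic R \<longleftrightarrow> (\<forall>v u u'. (v, u) \<in> R \<longrightarrow> (v, u') \<in> R \<longrightarrow>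
     (u, u') \<in> {(x, y) \<in> R. x \<noteq> v \<and> y \<noteq> v}\<^sup>* \<longrightarrow> u = u')"

lemma rel_dist_relpow: "(r, x) \<in> R\<^sup>* \<Longrightarrow> (r, x) \<in> R ^^ rel_dist R r x"
  unfolding rel_dist_def by (meson LeastI_ex rtrancl_imp_relpow)

lemma rel_dist_le: "(r, x) \<in> R ^^ n \<Longrightarrow> rel_dist R r x \<le> n"
  unfolding rel_dist_def by (rule Least_le)

lemma rel_dist_self [simp]: "rel_dist R r r = 0"
  using rel_dist_le[of r r 0 R] by simp

lemma rel_dist_step: "(r, x) \<in> R\<^sup>* \<Longrightarrow> (x, y) \<in> R \<Longrightarrow> rel_dist R r y \<le> Suc (rel_dist R r x)"
  by (meson rel_dist_relpow rel_dist_le relpow_Suc_I)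

lemma rel_dist_predecessor:
  assumes "(r, x) \<in> R\<^sup>*" "rel_dist R r x = Suc n"
  obtains y where "(y, x) \<in> R" "(r, y) \<in> R\<^sup>*" "rel_dist R r y = n"
proof -
  obtain y where y: "(r, y) \<in> R ^^ n" "(y, x) \<in> R"
    using rel_dist_relpow[OF assms(1)] assms(2) by auto
  then have reach: "(r, y) \<in> R\<^sup>*" by (rule_tac relpow_imp_rtrancl)
  have "rel_dist R r y = n"
    using rel_dist_le[OF y(1)] rel_dist_step[OF reach y(2)] assms(2) by simp
  with y reach that show thesis by blast
qed

text \<open>On a shortest walk to \<open>u\<close>, all earlier vertices are strictly closer to
  \<open>r\<close> than \<open>u\<close>, hence closer than \<open>v\<close>.\<close>

lemma shortest_path_avoids:
  assumes "(r, u) \<in> R\<^sup>*" "rel_dist R r u \<le> rel_dist R r v" "u \<noteq> v"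
  shows "(r, u) \<in> {(x, y) \<in> R. x \<noteq> v \<and> y \<noteq> v}\<^sup>*"
  using assms
proof (induction "rel_dist R r u" arbitrary: u)
  case 0
  then have "u = r" using rel_dist_relpow[of r u R] by simp
  then show ?case by simp
next
  case (Suc n)
  obtain y where y: "(y, u) \<in> R" "(r, y) \<in> R\<^sup>*" "rel_dist R r y = n"
    using rel_dist_predecessor[OF Suc.prems(1)] Suc.hyps(2) by metis
  then have "y \<noteq> v" using Suc by auto
  then have "(r, y) \<in> {(x, y) \<in> R. x \<noteq> v \<and> y \<noteq> v}\<^sup>*"
    using Suc y by simp
  then show ?case
    by (rule rtrancl_into_rtrancl) (use y Suc.prems \<open>y \<noteq> v\<close> in simp)
qed

text \<open>Shortest walks from \<open>r\<close> to \<open>u\<close> and \<open>u'\<close> avoid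
  \<open>v\<close>, so together they join two neighbours of \<open>v\<close> off \<open>v\<close>.
  Allowing equal distances also serves to exclude edges within one level.\<close>

lemma unique_closer_neighbour:
  assumes "sym R" "rel_acyclic R" "irrefl R" and "(r, v) \<in> R\<^sup>*"
    and "(v, u) \<in> R" "rel_dist R r u \<le> rel_dist R r v"
    and "(v, u') \<in> R" "rel_dist R r u' \<le> rel_dist R r v"
  shows "u = u'"
proof -
  let ?R' = "{(x, y) \<in> R. x \<noteq> v \<and> y \<noteq> v}"
  have "u \<noteq> v" "u' \<noteq> v" using assms by (auto simp: irrefl_def)
  moreover have "(r, u) \<in> R\<^sup>*" "(r, u') \<in> R\<^sup>*"
    using assms(4,5,7) by auto
  ultimately have "(r, u) \<in> ?R'\<^sup>*" "(r, u') \<in> ?R'\<^sup>*"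
    using assms by (auto intro!: shortest_path_avoids)
  moreover have "sym (?R'\<^sup>*)"
    using assms(1) by (intro sym_rtrancl) (auto simp: sym_def)
  ultimately have "(u, u') \<in> ?R'\<^sup>*"
    by (meson symD rtrancl_trans)
  with assms(2,5,7) show ?thesis unfolding rel_acyclic_def by blast
qed

text \<open>A vertex farthest from \<open>v\<close> is a leaf, since none of its neighbours is
  farther away.\<close>

lemma forest_component_has_leaf:
  assumes R: "sym R" "rel_acyclic R" "irrefl R" "finite R" and "(v, w) \<in> R"
  obtains l p where "(v, l) \<in> R\<^sup>*" "R `` {l} = {p}"
proof -
  let ?C = "R\<^sup>* `` {v}"
  have "?C \<subseteq> insert v (snd ` R)"
  proof
    fix x assume "x \<in> ?C"
    then have "(v, x) \<in> R\<^sup>*" by simp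
    then show "x \<in> insert v (snd ` R)"
      by (cases rule: rtranclE) (auto intro: rev_image_eqI)
  qed
  then have fin: "finite ?C"
    by (rule finite_subset) (simp add: R(4))
  then have "Max (rel_dist R v ` ?C) \<in> rel_dist R v ` ?C"
    by (intro Max_in) auto
  then obtain l where l: "(v, l) \<in> R\<^sup>*" "Max (rel_dist R v ` ?C) = rel_dist R v l"
    by auto
  then have max: "rel_dist R v x \<le> rel_dist R v l" if "(v, x) \<in> R\<^sup>*" for x
    using Max_ge[of "rel_dist R v ` ?C" "rel_dist R v x"] fin that by auto
  note l = l(1)
  have "\<exists>p. (l, p) \<in> R"
  proof (cases "l = v")
    case False
    then show ?thesis
      using l R(1) by (metis rtranclE symD)
  qed (use assms in blast)
  then obtain p where p: "(l, p) \<in> R" ..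
  have "x = p" if "(l, x) \<in> R" for x
    using unique_closer_neighbour[OF R(1-3) l that _ p] max l that p
    by (meson rtrancl_into_rtrancl)
  with p have "R `` {l} = {p}" by blast
  with l that show thesis by blast
qed

text \<open>\<open>D\<close> is the distance to a root chosen in each component: a neighbour of a
  leaf, or the vertex itself if it is isolated.\<close>

lemma forest_rooting_exists:
  assumes R: "sym R" "rel_acyclic R" "irrefl R" "finite R"
    and no_isolated: "\<And>u v. R `` {u} = {v} \<Longrightarrow> R `` {v} \<noteq> {u}"
  obtains D :: "'a \<Rightarrow> nat" where
    "\<And>u v. (u, v) \<in> R \<Longrightarrow> D u = Suc (D v) \<or> D v = Suc (D u)"
    "\<And>v n. D v = Suc n \<Longrightarrow> \<exists>!u. (v, u) \<in> R \<and> D u = n"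
    "\<And>v. D v = 0 \<Longrightarrow> R `` {v} \<noteq> {} \<Longrightarrow>
       2 \<le> card (R `` {v}) \<and> (\<exists>l. R `` {l} = {v})"
proof -
  define good where "good r \<longleftrightarrow> R `` {r} = {} \<or> 2 \<le> card (R `` {r}) \<and> (\<exists>l. R `` {l} = {r})" for r
  have good_ex: "\<exists>r. (v, r) \<in> R\<^sup>* \<and> good r" for v
  proof (cases "R `` {v} = {}")
    case True
    then show ?thesis unfolding good_def by blast
  next
    case False
    then obtain w where "(v, w) \<in> R" by blast
    then obtain l p where l: "(v, l) \<in> R\<^sup>*" "R `` {l} = {p}"
      using forest_component_has_leaf[OF R] by blast
    have "(l, p) \<in> R" using l(2) by blast
    then have "l \<in> R `` {p}" using R(1) by (auto dest: symD)
    \<comment> \<open>Otherwise \<open>l\<close> and \<open>p\<close> would form an isolated edge;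
      so \<open>p\<close> has a second neighbour.\<close>
    moreover have "R `` {p} \<noteq> {l}" by (rule no_isolated) fact
    ultimately obtain x where x: "{l, x} \<subseteq> R `` {p}" "x \<noteq> l" by blast
    have "finite (R `` {p})"
      using R(4) by (simp add: finite_Image)
    then have "card {l, x} \<le> card (R `` {p})"
      using x(1) by (rule card_mono)
    then have "good p" using x(2) l(2) unfolding good_def by auto
    moreover have "(v, p) \<in> R\<^sup>*" using l(1) \<open>(l, p) \<in> R\<close> by simp
    ultimately show ?thesis by blast
  qed
  define root where "root v = (SOME r. (v, r) \<in> R\<^sup>* \<and> good r)" for v
  define D where "D v = rel_dist R (root v) v" for v
  have symR: "sym (R\<^sup>*)" using R(1) by (rule sym_rtrancl)
  have root: "(root v, v) \<in> R\<^sup>*" "good (root v)" for v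
    using someI_ex[OF good_ex[of v]] symR unfolding root_def by (auto dest: symD)
  \<comment> \<open>Adjacent vertices reach the same vertices, so \<open>SOME\<close> is applied to
    the same predicate and picks one root per component.\<close>
  have root_eq: "root u = root v" if "(u, v) \<in> R" for u v
  proof -
    have "(u, r) \<in> R\<^sup>* \<longleftrightarrow> (v, r) \<in> R\<^sup>*" for r
      using that R(1) by (meson converse_rtrancl_into_rtrancl symD)
    then show ?thesis unfolding root_def by simp
  qed
  have parent: "\<exists>u. (v, u) \<in> R \<and> D u = n" if Dv: "D v = Suc n" for v n
  proof -
    obtain u where u: "(u, v) \<in> R" "rel_dist R (root v) u = n"
      using rel_dist_predecessor[OF root(1) Dv[unfolded D_def]] by blast
    then have "(v, u) \<in> R" using R(1) by (auto dest: symD)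
    with u(2) show ?thesis using root_eq[OF u(1)] unfolding D_def by auto
  qed
  have unique: "u = u'" if "(v, u) \<in> R" "D u \<le> D v" "(v, u') \<in> R" "D u' \<le> D v" for v u u'
  proof (rule unique_closer_neighbour[OF R(1-3) root(1)[of v] that(1) _ that(3)])
    show "rel_dist R (root v) u \<le> rel_dist R (root v) v"
      using that(2) root_eq[OF that(1)] by (simp add: D_def)
    show "rel_dist R (root v) u' \<le> rel_dist R (root v) v"
      using that(4) root_eq[OF that(3)] by (simp add: D_def)
  qed
  have zero: "root v = v" if "D v = 0" for v
    using rel_dist_relpow[OF root(1)[of v]] that unfolding D_def by simp
  have step: "D v \<le> Suc (D u)" if "(u, v) \<in> R" for u v
    using rel_dist_step[OF root(1)[of u] that] root_eq[OF that] unfolding D_def by simp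
  \<comment> \<open>At depth 0 both ends would be their own common root. At positive depth the
    parent of \<open>u\<close> and the vertex \<open>v\<close> would be two neighbours of
    \<open>u\<close> that are no deeper than \<open>u\<close>.\<close>
  have neq: "D u \<noteq> D v" if uv: "(u, v) \<in> R" for u v
  proof
    assume eq: "D u = D v"
    show False
    proof (cases "D u")
      case 0
      then have "u = v" using zero root_eq[OF uv] eq by metis
      with uv R(3) show False by (simp add: irrefl_def)
    next
      case (Suc n)
      then obtain p where p: "(u, p) \<in> R" "D p = n" using parent by blast
      then have "p = v" using unique[OF p(1) _ uv] eq Suc by simp
      with p eq Suc show False by simp
    qed
  qed
  show thesis
  proof (rule that[of D])
    show "D u = Suc (D v) \<or> D v = Suc (D u)" if "(u, v) \<in> R" for u v
      using step[OF that] step[of v u] neq[OF that] R(1) that by (auto dest: symD)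
    show "\<exists>!u. (v, u) \<in> R \<and> D u = n" if "D v = Suc n" for v n
      using parent[OF that] unique[of v] that by (metis le_SucI order_refl)
    show "2 \<le> card (R `` {v}) \<and> (\<exists>l. R `` {l} = {v})" if "D v = 0" "R `` {v} \<noteq> {}" for v
      using root(2)[of v] zero[OF that(1)] that(2) unfolding good_def by simp
  qed
qed

section \<open>Labelling a rooted forest\<close>

text \<open>Serves to hand the label 0 of a root to its leaf.\<close>

lemma bij_betw_prescribed_value:
  assumes "finite C" "finite A" "card C = card A" "l \<in> C" "z \<in> A"
  obtains h where "bij_betw h C A" "h l = z"
proof -
  have "card (C - {l}) = card (A - {z})" using assms by simp
  then obtain g where g: "bij_betw g (C - {l}) (A - {z})"
    using finite_same_card_bij[of "C - {l}" "A - {z}"] assms(1,2) by blast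
  have "bij_betw (g(l := z)) (C - {l} \<union> {l}) (A - {z} \<union> {(g(l := z)) l})"
  proof (rule notIn_Un_bij_betw)
    show "bij_betw (g(l := z)) (C - {l}) (A - {z})"
      using g by (rule bij_betw_cong[THEN iffD1, rotated]) auto
  qed auto
  moreover have "C - {l} \<union> {l} = C" "A - {z} \<union> {(g(l := z)) l} = A" using assms by auto
  ultimately show thesis using that[of "g(l := z)"] by simp
qed

text \<open>From here on, acyclicity enters only through the uniqueness of parents.\<close>

locale rooted_forest =
  fixes R :: "('a \<times> 'a) set" and D :: "'a \<Rightarrow> nat"
  assumes sym_R: "sym R" and finite_R: "finite R"
    and depth_step: "(u, v) \<in> R \<Longrightarrow> D u = Suc (D v) \<or> D v = Suc (D u)"
    and ex1_parent: "D v = Suc n \<Longrightarrow> \<exists>!u. (v, u) \<in> R \<and> D u = n"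
    and root: "D v = 0 \<Longrightarrow> R `` {v} \<noteq> {} \<Longrightarrow>
      2 \<le> card (R `` {v}) \<and> (\<exists>l. R `` {l} = {v})"
begin

definition children :: "'a \<Rightarrow> 'a set" where
  "children v = {x. (v, x) \<in> R \<and> D x = Suc (D v)}"

definition parent :: "'a \<Rightarrow> 'a" where
  "parent v = (THE u. (v, u) \<in> R \<and> D v = Suc (D u))"

lemma parent:
  assumes "D v \<noteq> 0"
  shows "(v, parent v) \<in> R" "D v = Suc (D (parent v))"
proof -
  obtain n where n: "D v = Suc n" using assms by (cases "D v") auto
  have "\<exists>!u. (v, u) \<in> R \<and> D v = Suc (D u)"
    using ex1_parent[OF n] n by auto
  from theI'[OF this] show "(v, parent v) \<in> R" "D v = Suc (D (parent v))"
    unfolding parent_def by auto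
qed

lemma parent_eqI:
  assumes "(v, u) \<in> R" "D v = Suc (D u)"
  shows "parent v = u"
  using ex1_parent[OF assms(2)] parent[of v] assms by force

lemma parent_of_child: "x \<in> children v \<Longrightarrow> parent x = v"
  using sym_R by (intro parent_eqI) (auto simp: children_def dest: symD)

lemma child_of_parent: "D v \<noteq> 0 \<Longrightarrow> v \<in> children (parent v)"
  using parent[of v] sym_R by (auto simp: children_def dest: symD)

lemma neighbours_eq: "R `` {v} = (if D v = 0 then children v else insert (parent v) (children v))"
proof -
  have "x \<in> children v \<or> D v \<noteq> 0 \<and> x = parent v" if "(v, x) \<in> R" for x
    using depth_step[OF that] parent_eqI[OF that] that by (auto simp: children_def)
  moreover have "children v \<subseteq> R `` {v}" by (auto simp: children_def)
  ultimately show ?thesis using parent[of v] by auto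
qed

lemma finite_neighbours: "finite (R `` {v})"
  using finite_R by (simp add: finite_Image)

lemma finite_children: "finite (children v)"
  by (rule finite_subset[OF _ finite_neighbours[of v]]) (auto simp: children_def)

lemma parent_not_child: "D v \<noteq> 0 \<Longrightarrow> parent v \<notin> children v"
  using parent[of v] by (auto simp: children_def)

text \<open>
  \<open>F u x\<close> is the label of the edge from \<open>u\<close> to its child \<open>x\<close>, and \<open>h\<close> is a candidate for \<open>F v\<close>;
  the conditions on \<open>h\<close> involve \<open>F\<close> only at vertices above \<open>v\<close>, so that \<open>F\<close> can be chosen recursively.
\<close>

definition total :: "nat \<Rightarrow> ('a \<Rightarrow> 'a \<Rightarrow> nat) \<Rightarrow> 'a \<Rightarrow> ('a \<Rightarrow> nat) \<Rightarrow> nat" where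
  "total k F v h = ((if D v = 0 then 0 else F (parent v) v) + sum h (children v)) mod k"

text \<open>Requiring \<open>h x\<close> to differ from the total provides the hypothesis that
  \<open>a\<close> is not \<open>c\<close> one level down, and settles the edge to \<open>x\<close>
  if \<open>x\<close> is a leaf. Label 0 is confined to leaves because
  \<open>child_labels_exist\<close> needs a nonzero parent label.\<close>

definition admissible :: "nat \<Rightarrow> ('a \<Rightarrow> 'a \<Rightarrow> nat) \<Rightarrow> 'a \<Rightarrow> ('a \<Rightarrow> nat) \<Rightarrow> bool" where
  "admissible k F v h \<longleftrightarrow>
     inj_on h (children v) \<and>
     (\<forall>x\<in>children v. h x < k \<and> h x \<noteq> total k F v h \<and> (h x = 0 \<longrightarrow> children x = {})) \<and>
     (D v \<noteq> 0 \<longrightarrow> F (parent v) v \<notin> h ` children v \<and>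
        total k F v h \<noteq> total k F (parent v) (F (parent v)))"

lemma total_cong:
  assumes "\<And>z. D z < D v \<Longrightarrow> F z = F' z"
  shows "total k F v h = total k F' v h"
  using assms[of "parent v"] parent[of v] unfolding total_def by auto

lemma admissible_cong:
  assumes "\<And>z. D z < D v \<Longrightarrow> F z = F' z"
  shows "admissible k F v h = admissible k F' v h"
proof -
  have "total k F v h = total k F' v h"
    by (rule total_cong) (rule assms)
  moreover have "F (parent v) = F' (parent v)"
    and "total k F (parent v) (F (parent v)) = total k F' (parent v) (F' (parent v))"
    if "D v \<noteq> 0"
  proof -
    show eq: "F (parent v) = F' (parent v)"
      using assms parent[OF that] by simp
    show "total k F (parent v) (F (parent v)) = total k F' (parent v) (F' (parent v))"
      unfolding eq using assms parent[OF that] by (intro total_cong) simp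
  qed
  ultimately show ?thesis unfolding admissible_def by simp
qed

lemma admissible_root_exists:
  assumes k: "odd k" "5 \<le> k" and deg: "card (R `` {v}) \<le> k - 2" and "D v = 0"
  shows "\<exists>h. admissible k F v h"
proof (cases "children v = {}")
  case True
  then show ?thesis using \<open>D v = 0\<close> by (auto simp: admissible_def)
next
  case False
  have nb: "R `` {v} = children v" using \<open>D v = 0\<close> by (simp add: neighbours_eq)
  then obtain l where l: "R `` {l} = {v}" and two: "2 \<le> card (children v)"
    using root[OF \<open>D v = 0\<close>] False by auto
  have "(l, v) \<in> R" using l by blast
  then have l_child: "l \<in> children v" using nb sym_R by (auto dest: symD)
  have l_leaf: "children l = {}"
  proof -
    have "x = v" if "(l, x) \<in> R" for x using l that by blast
    then show ?thesis using \<open>D v = 0\<close> by (force simp: children_def)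
  qed
  obtain A where A: "A \<subseteq> {..<k}" "card A = card (children v)" "\<Sum>A mod k \<notin> A"
    using root_labels_exist[OF k two] deg nb by auto
  have finA: "finite A" using A(1) by (rule finite_subset) simp
  have "A \<noteq> {}" using A(2) two by auto
  \<comment> \<open>The leaf \<open>l\<close> receives \<open>z\<close>, so if 0 occurs among the
    labels, it goes to \<open>l\<close>.\<close>
  then obtain z where z: "z \<in> A" "0 \<in> A \<longrightarrow> z = 0" by blast
  obtain h where h: "bij_betw h (children v) A" "h l = z"
    using bij_betw_prescribed_value[OF finite_children finA A(2)[symmetric] l_child z(1)] by blast
  have inj: "inj_on h (children v)" and img: "h ` children v = A"
    using h(1) by (auto simp: bij_betw_def)
  have "total k F v h = \<Sum>A mod k"
    using \<open>D v = 0\<close> sum.reindex_bij_betw[OF h(1), of id] by (simp add: total_def)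
  moreover have "children x = {}" if "x \<in> children v" "h x = 0" for x
  proof -
    have "h l = h x" using that img z h(2) by force
    then have "x = l" using inj that(1) l_child by (auto dest: inj_onD)
    then show ?thesis using l_leaf by simp
  qed
  moreover have "h x \<in> A" if "x \<in> children v" for x
    using img that by blast
  ultimately have "admissible k F v h"
    using inj A(1,3) \<open>D v = 0\<close> unfolding admissible_def by (metis lessThan_iff subsetD)
  then show ?thesis by blast
qed

lemma admissible_nonroot_exists:
  assumes k: "odd k" "5 \<le> k" and deg: "card (R `` {v}) \<le> k - 2" and "D v \<noteq> 0"
    and par: "admissible k F (parent v) (F (parent v))"
  shows "\<exists>h. admissible k F v h"
proof -
  define c where "c = F (parent v) v"
  define a where "a = total k F (parent v) (F (parent v))"
  have c: "c < k" "c \<noteq> a" "c = 0 \<longrightarrow> children v = {}"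
    using par child_of_parent[OF \<open>D v \<noteq> 0\<close>] unfolding admissible_def c_def a_def by auto
  show ?thesis
  proof (cases "children v = {}")
    case True
    \<comment> \<open>A leaf has the label of its only edge as colour; \<open>h\<close> is arbitrary
      here.\<close>
    then have "total k F v (\<lambda>_. 0) = c"
      using c \<open>D v \<noteq> 0\<close> by (simp add: total_def c_def)
    then have "admissible k F v (\<lambda>_. 0)"
      using c True by (simp add: admissible_def flip: c_def a_def)
    then show ?thesis by blast
  next
    case False
    \<comment> \<open>The parent edge takes one unit of the degree bound, which turns
      \<open>k - 2\<close> into \<open>k - 3\<close>.\<close>
    have "card (R `` {v}) = Suc (card (children v))"
      using \<open>D v \<noteq> 0\<close> parent_not_child finite_children by (simp add: neighbours_eq)
    then have "card (children v) \<le> k - 3" using deg by simp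
    moreover have "1 \<le> card (children v)"
      using False finite_children by (simp add: Suc_le_eq card_gt_0_iff)
    ultimately obtain A where A: "A \<subseteq> {1..<k} - {c}" "card A = card (children v)"
      "(c + \<Sum>A) mod k \<notin> A" "(c + \<Sum>A) mod k \<noteq> a"
      using child_labels_exist[OF k, of c a "card (children v)"] c False by auto
    have "finite A" using A(1) by (rule finite_subset) simp
    then obtain h where h: "bij_betw h (children v) A"
      using finite_same_card_bij[OF finite_children[of v]] A(2) by metis
    have inj: "inj_on h (children v)" and img: "h ` children v = A"
      using h by (auto simp: bij_betw_def)
    have "total k F v h = (c + \<Sum>A) mod k"
      using \<open>D v \<noteq> 0\<close> sum.reindex_bij_betw[OF h, of id] by (simp add: total_def c_def)
    moreover have "h x \<in> A" if "x \<in> children v" for x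
      using img that by blast
    moreover have "c \<notin> A" "\<And>x. x \<in> A \<Longrightarrow> 0 < x \<and> x < k"
      using A(1) by auto
    ultimately have "admissible k F v h"
      using inj img A(3,4) \<open>D v \<noteq> 0\<close> unfolding admissible_def c_def a_def
      by (metis less_irrefl)
    then show ?thesis by blast
  qed
qed

text \<open>Recursion on depth: \<open>admissible_cong\<close> makes the condition at
  \<open>v\<close> depend only on smaller depths, and the two existence lemmas provide the next
  choice.\<close>

lemma admissible_labels_exist:
  assumes k: "odd k" "5 \<le> k" and deg: "\<And>v. card (R `` {v}) \<le> k - 2"
  obtains F where "\<And>v. admissible k F v (F v)"
proof -
  have "\<exists>F. \<forall>v. admissible k F v (F v)"
  proof (rule dependent_wf_choice[where R = "measure D"])
    show "wf (measure D)" by simp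
    show "admissible k F v h = admissible k F' v h"
      if "\<And>z. (z, v) \<in> measure D \<Longrightarrow> F z = F' z" for F F' v h
      by (rule admissible_cong) (use that in simp)
    show "\<exists>h. admissible k F v h"
      if "\<And>y. (y, v) \<in> measure D \<Longrightarrow> admissible k F y (F y)" for v F
    proof (cases "D v = 0")
      case True
      then show ?thesis by (rule admissible_root_exists[OF k deg])
    next
      case False
      then show ?thesis
        using that[of "parent v"] parent(2)[OF False] by (intro admissible_nonroot_exists[OF k deg]) auto
    qed
  qed
  with that show thesis by blast
qed

lemma twin_labels_exist:
  assumes k: "odd k" "5 \<le> k" and deg: "\<And>v. card (R `` {v}) \<le> k - 2"
  obtains f :: "'a set \<Rightarrow> nat" where
    "\<And>u v. (u, v) \<in> R \<Longrightarrow> f {u, v} < k"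
    "\<And>v. inj_on (\<lambda>u. f {u, v}) (R `` {v})"
    "\<And>u v. (u, v) \<in> R \<Longrightarrow>
       (\<Sum>x\<in>R `` {u}. f {x, u}) mod k \<noteq> (\<Sum>x\<in>R `` {v}. f {x, v}) mod k"
proof -
  obtain F where F: "\<And>v. admissible k F v (F v)"
    using admissible_labels_exist[OF assms] by blast
  \<comment> \<open>The deeper end of an edge, well defined because depths differ by one along
    edges. It lets the label be read off from the unordered pair.\<close>
  define low where "low e = (THE x. x \<in> e \<and> (\<exists>y\<in>e. D x = Suc (D y)))" for e
  define f where "f e = F (parent (low e)) (low e)" for e
  have f_child: "f {x, v} = F v x" if "x \<in> children v" for x v
  proof -
    have "low {x, v} = x"
      unfolding low_def using that by (intro the_equality) (auto simp: children_def)
    then show ?thesis using parent_of_child[OF that] by (simp add: f_def)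
  qed
  have f_parent: "f {parent v, v} = F (parent v) v" if "D v \<noteq> 0" for v
    using f_child[OF child_of_parent[OF that]] by (simp add: insert_commute)
  have w: "(\<Sum>x\<in>R `` {v}. f {x, v}) mod k = total k F v (F v)" for v
    using f_parent[of v] f_child parent_not_child[of v] finite_children[of v]
    by (simp add: neighbours_eq total_def)
  have w_parent: "total k F v (F v) \<noteq> total k F (parent v) (F (parent v))" if "D v \<noteq> 0" for v
    using F[of v] that unfolding admissible_def by blast
  show thesis
  proof (rule that[of f])
    fix u v assume uv: "(u, v) \<in> R"
    then have vu: "(v, u) \<in> R" using sym_R by (auto dest: symD)
    have less: "f {x, y} < k" if "x \<in> children y" for x y
      using f_child[OF that] F[of y] that by (simp add: admissible_def)
    have "u \<in> children v \<or> v \<in> children u"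
      using depth_step[OF uv] uv vu by (auto simp: children_def)
    then show "f {u, v} < k"
      using less[of u v] less[of v u] by (auto simp: insert_commute)
    show "(\<Sum>x\<in>R `` {u}. f {x, u}) mod k \<noteq> (\<Sum>x\<in>R `` {v}. f {x, v}) mod k"
      unfolding w using depth_step[OF uv] w_parent[of u] w_parent[of v]
        parent_eqI[OF uv] parent_eqI[OF vu] by force
  next
    fix v
    have "inj_on (\<lambda>u. f {u, v}) (children v)"
      using F[of v] f_child by (auto simp: admissible_def inj_on_def)
    moreover have "f {parent v, v} \<notin> (\<lambda>u. f {u, v}) ` children v" if "D v \<noteq> 0"
      using F[of v] f_child f_parent[OF that] that by (auto simp: admissible_def)
    ultimately show "inj_on (\<lambda>u. f {u, v}) (R `` {v})"
      using parent_not_child[of v] by (simp add: neighbours_eq)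
  qed
qed

end

section \<open>Digraph forests\<close>

lemma neighbourhood_eq_Image: "neighbourhood G v = arcs_ends G `` {v}"
  by (auto simp: neighbourhood_def)

text \<open>Turns the hypothesis on isolated edges into a condition on neighbour sets. A connected
  subgraph containing \<open>u\<close> and \<open>v\<close> cannot leave \<open>{u, v}\<close>,
  which makes the induced subgraph maximal.\<close>

lemma (in graph) isolated_edge_induce:
  assumes u: "arcs_ends G `` {u} = {v}" and v: "arcs_ends G `` {v} = {u}"
  shows "isolated_edge G (G \<restriction> {u, v})"
proof -
  let ?H = "G \<restriction> {u, v}"
  have uv: "(u, v) \<in> arcs_ends G" "(v, u) \<in> arcs_ends G" using u v by blast+
  have "u \<noteq> v" using uv(1) adj_not_same by blast
  have uv_verts: "{u, v} \<subseteq> verts G" using uv by (auto dest: adj_in_verts)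
  have induced: "induced_subgraph ?H G"
    using uv_verts by (rule induced_induce)
  then have sub: "subgraph ?H G" by (rule induced_imp_subgraph)
  have "graph ?H"
    using digraphI_induced[OF induced] induced_graph_imp_symmetric[OF sym_arcs induced]
    by (rule digraph.graphI)
  have ends: "arcs_ends ?H = {(u, v), (v, u)}"
  proof -
    have "arcs_ends ?H = arcs_ends G \<inter> {u, v} \<times> {u, v}"
      by (auto simp: arcs_ends_conv induce_subgraph_def)
    then show ?thesis using uv u v \<open>u \<noteq> v\<close> by auto
  qed
  have complete: "complete_digraph 2 ?H"
    unfolding complete_digraph_def using \<open>graph ?H\<close> ends \<open>u \<noteq> v\<close> by auto
  have "connected ?H"
  proof -
    interpret H: graph ?H by fact
    have "x \<rightarrow>\<^sup>*\<^bsub>?H\<^esub> y" if "x \<in> {u, v}" "y \<in> {u, v}" for x y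
      using that ends by auto
    then show ?thesis
      unfolding connected_def
      by (intro strongly_connectedI) (auto intro: H.reachable_mk_symmetricI)
  qed
  moreover have "H' = ?H" if H': "subgraph ?H H'" "subgraph H' G" "connected H'" for H'
  proof -
    \<comment> \<open>Connectedness of \<open>H'\<close> is stated for its symmetric closure, whose
      arcs still lie in the symmetric \<open>G\<close>.\<close>
    have ends': "parcs (mk_symmetric H') \<subseteq> arcs_ends G"
      using arcs_ends_mono[OF H'(2)] graph_symmetric
      by (fastforce simp: parcs_mk_symmetric arcs_ends_conv)
    have "w \<in> {u, v}" if "w \<in> verts H'" for w
    proof -
      have "u \<in> verts H'" using H'(1) by (auto simp: subgraph_def)
      then have "u \<rightarrow>\<^sup>*\<^bsub>mk_symmetric H'\<^esub> w"
        using H'(3) that unfolding connected_def strongly_connected_def by simp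
      then have "(u, w) \<in> (parcs (mk_symmetric H'))\<^sup>*"
        unfolding reachable_def by (auto dest: rtrancl_on_rtranclI)
      then have "(u, w) \<in> (arcs_ends G)\<^sup>*"
        using rtrancl_mono[OF ends'] by blast
      then show ?thesis
        by (induction rule: rtrancl_induct) (use u v in blast)+
    qed
    then have "verts H' = verts ?H" using H'(1) by (auto simp: subgraph_def)
    then show ?thesis
      using H' induced by (intro pre_digraph.equality) (auto simp: subgraph_def compatible_def wf_digraph_def)
  qed
  ultimately show ?thesis
    unfolding isolated_edge_def max_subgraph_def using sub complete by auto
qed

text \<open>A path from \<open>u\<close> to \<open>u'\<close> off \<open>v\<close> closes through
  \<open>v\<close> to a cycle.\<close>

lemma (in graph) rel_acyclic_arcs_ends:
  assumes "\<not> (\<exists>p. cycle p \<and> 3 \<le> length p)"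
  shows "rel_acyclic (arcs_ends G)"
  unfolding rel_acyclic_def
proof (intro allI impI)
  fix v u u'
  assume vu: "(v, u) \<in> arcs_ends G" and vu': "(v, u') \<in> arcs_ends G"
    and reach: "(u, u') \<in> {(x, y) \<in> arcs_ends G. x \<noteq> v \<and> y \<noteq> v}\<^sup>*"
  show "u = u'"
  proof (rule ccontr)
    assume "u \<noteq> u'"
    have "\<exists>p. awalk u p u' \<and> v \<notin> set (awalk_verts u p)"
      using reach
    proof (induction rule: converse_rtrancl_induct)
      case base
      then show ?case using vu'
        by (intro exI[of _ "[]"]) (auto simp: awalk_Nil_iff dest: adj_in_verts adj_not_same)
    next
      case (step x y)
      then obtain p e where "awalk y p u'" "v \<notin> set (awalk_verts y p)"
         "e \<in> arcs G" "tail G e = x" "head G e = y" "x \<noteq> v"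
        by (auto simp: arcs_ends_conv)
      then show ?case by (intro exI[of _ "e # p"]) (auto simp: awalk_Cons_iff)
    qed
    then obtain p where p: "awalk u p u'" "v \<notin> set (awalk_verts u p)" by blast
    \<comment> \<open>Shortening the walk to a path makes its vertices distinct and adds none, so
      \<open>v\<close> is still avoided.\<close>
    define q where "q = awalk_to_apath p"
    have q: "apath u q u'" "v \<notin> set (awalk_verts u q)"
      using apath_awalk_to_apath[OF p(1)] awalk_to_apath_subset[OF p(1)] p(2)
      set_awalk_verts[OF p(1)] set_awalk_verts[of u q u'] unfolding q_def
      by (auto dest: awalkI_apath)
    obtain e where e: "e \<in> arcs G" "tail G e = v" "head G e = u" using vu by (auto simp: arcs_ends_conv)
    obtain e' where e': "e' \<in> arcs G" "tail G e' = u'" "head G e' = v"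
      using graph_symmetric[OF vu'] by (auto simp: arcs_ends_conv)
    have "awalk v (e # q @ [e']) v"
      using q e e' by (auto simp: awalk_Cons_iff awalk_Nil_iff apath_def)
    moreover have "distinct (tl (awalk_verts v (e # q @ [e'])))"
    proof -
      have "awalk_verts u (q @ [e']) = awalk_verts u q @ [v]"
        using q(1) e' by (subst awalk_verts_append[of _ _ _ v]) (auto simp: apath_def awalk_simps)
      then show ?thesis using q e(3) by (simp add: apath_def)
    qed
    \<comment> \<open>The path has at least one arc, and the two arcs at \<open>v\<close> bring the
      length to 3.\<close>
    moreover have "q \<noteq> []" using q(1) \<open>u \<noteq> u'\<close> by (auto simp: apath_Nil_iff)
    then have "3 \<le> length (e # q @ [e'])" by (cases q) auto
    ultimately show False using assms unfolding cycle_def by blast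
  qed
qed

text \<open>Adjacent edges share a vertex, so injectivity of the labels around each vertex already
  gives properness.\<close>

lemma (in graph) twin_edge_coloring_arcs_endsI:
  assumes less: "\<And>u v. (u, v) \<in> arcs_ends G \<Longrightarrow> f {u, v} < k"
    and inj: "\<And>v. inj_on (\<lambda>u. f {u, v}) (arcs_ends G `` {v})"
    and neq: "\<And>u v. (u, v) \<in> arcs_ends G \<Longrightarrow>
      (\<Sum>x\<in>arcs_ends G `` {u}. f {x, u}) mod k \<noteq> (\<Sum>x\<in>arcs_ends G `` {v}. f {x, v}) mod k"
  shows "twin_edge_coloring G k f"
  unfolding twin_edge_coloring_def proper_edge_labeling_def
proof (intro conjI ballI allI impI)
  fix e assume "e \<in> edges G"
  then show "f e < k" using less by (auto simp: edges_def)
next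
  fix e e' assume e: "e \<in> edges G" "e' \<in> edges G" and ne: "e \<noteq> e' \<and> e \<inter> e' \<noteq> {}"
  have edge: "\<exists>y. e = {y, x} \<and> y \<in> arcs_ends G `` {x}" if "e \<in> edges G" "x \<in> e" for e x
    using that graph_symmetric by (auto simp: edges_def)
  obtain x where "x \<in> e" "x \<in> e'" using ne by blast
  then obtain y y' where "e = {y, x}" "y \<in> arcs_ends G `` {x}"
    "e' = {y', x}" "y' \<in> arcs_ends G `` {x}"
    using edge e by meson
  with ne inj[of x] show "f e \<noteq> f e'" by (auto dest: inj_onD)
next
  fix u v assume "u \<rightarrow>\<^bsub>G\<^esub> v"
  then show "induced_color G k f u \<noteq> induced_color G k f v"
    unfolding induced_color_def neighbourhood_eq_Image by (rule neq)
qed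

lemma (in graph) card_neighbours_le_max_degree: "card (arcs_ends G `` {v}) \<le> max_degree G"
proof (cases "v \<in> verts G")
  case True
  then show ?thesis
    unfolding max_degree_def neighbourhood_eq_Image by (intro cSUP_upper) auto
next
  case False
  then have "arcs_ends G `` {v} = {}" by (auto dest: adj_in_verts)
  then show ?thesis by simp
qed

theorem theorem6:
  fixes G :: "('a, 'b) pre_digraph"
  assumes "undirected_forest G"
    and "\<not> (\<exists>H. isolated_edge G H)"
  shows "twin_chromatic_index G \<le>
    (if odd (max_degree G) then enat (max_degree G + 2) else enat (max_degree G + 3))"
proof -
  interpret graph G using assms(1) by (simp add: undirected_forest_def)
  let ?R = "arcs_ends G"
  define k where "k = (if odd (max_degree G) then max_degree G + 2 else max_degree G + 3)"
  have R: "sym ?R" "irrefl ?R" "finite ?R"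
    using graph_symmetric adj_not_same by (auto simp: sym_def irrefl_def arcs_ends_conv)
  have acyclic: "rel_acyclic ?R"
    using assms(1) by (intro rel_acyclic_arcs_ends) (simp add: undirected_forest_def)
  have no_isolated: "?R `` {v} \<noteq> {u}" if "?R `` {u} = {v}" for u v
    using isolated_edge_induce[OF that] assms(2) by blast
  have "\<exists>f. twin_edge_coloring G k f"
  proof (cases "?R = {}")
    \<comment> \<open>Without edges \<open>k\<close> is only 3, below the bound 5 of the label
      lemmas, but every condition is vacuous.\<close>
    case True
    then have "twin_edge_coloring G k (\<lambda>_. 0)"
      by (intro twin_edge_coloring_arcs_endsI) auto
    then show ?thesis by blast
  next
    case False
    obtain D :: "'a \<Rightarrow> nat" where D:
      "\<And>u v. (u, v) \<in> ?R \<Longrightarrow> D u = Suc (D v) \<or> D v = Suc (D u)"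
      "\<And>v n. D v = Suc n \<Longrightarrow> \<exists>!u. (v, u) \<in> ?R \<and> D u = n"
      "\<And>v. D v = 0 \<Longrightarrow> ?R `` {v} \<noteq> {} \<Longrightarrow>
         2 \<le> card (?R `` {v}) \<and> (\<exists>l. ?R `` {l} = {v})"
      using forest_rooting_exists[OF R(1) acyclic R(2,3) no_isolated] by blast
    interpret rooted_forest ?R D
      by unfold_locales (use R D in blast)+
    obtain u v where uv: "(u, v) \<in> ?R" using False by auto
    have vu: "(v, u) \<in> ?R" using uv by (rule graph_symmetric)
    \<comment> \<open>If all degrees were at most 1, the edge \<open>uv\<close> would be isolated. A
      maximum degree of at least 2 then yields \<open>5 \<le> k\<close>.\<close>
    have "\<exists>r. 2 \<le> card (?R `` {r})"
    proof (rule ccontr)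
      assume "\<not> ?thesis"
      then have "card (?R `` {r}) \<le> Suc 0" for r
        by (metis not_less_eq_eq numeral_2_eq_2)
      then have "?R `` {u} = {v}" "?R `` {v} = {u}"
        using uv vu finite_neighbours by (auto simp: card_le_Suc0_iff_eq)
      then show False using no_isolated by blast
    qed
    then obtain r where r: "2 \<le> card (?R `` {r})" ..
    then have "2 \<le> max_degree G"
      using card_neighbours_le_max_degree[of r] by simp
    then have k: "odd k" "5 \<le> k" unfolding k_def by presburger+
    have "card (?R `` {v}) \<le> k - 2" for v
      using card_neighbours_le_max_degree[of v] unfolding k_def by auto
    then show ?thesis
      using twin_labels_exist[OF k] twin_edge_coloring_arcs_endsI by metis
  qed
  then have "twin_chromatic_index G \<le> enat k"
    unfolding twin_chromatic_index_def by (intro INF_lower) (simp add: k_def)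
  then show ?thesis by (cases "odd (max_degree G)") (simp_all add: k_def)
qed

end
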